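(* Let $r$ and $n$ be positive integers. If $k=\left(1-\frac1r+\frac1{r!}\right)r!$, then $f(n,r,k)\ge n/r!$. It follows that the linear path threshold is at most $\left(1-\frac1r+\frac1{r!}\right)r!$.
   Context: An $r$-digraph $G$ consists of a finite vertex set $V(G)$ and an edge set $E(G)$ whose elements are ordered lists of $r$ distinct vertices. An $(r,k)$-tournament ($0\le k\le r!$) is an $r$-digraph $G$ such that for every $r$-element set $S\subseteq V(G)$, exactly $k$ of the $r!$ orderings of $S$ are edges of $G$. The tight path $P^{(r)}_s$ is the $r$-digraph with $s$ distinct vertices $v_1,\ldots,v_s$ whose edges are exactly the lists of $r$ consecutive vertices $(v_i,\ldots,v_{i+r-1})$, $1\le i\le s-r+1$ (no edges if $s<r$). An $r$-digraph $G$ contains $P^{(r)}_s$ if there is an injection of its vertices into $V(G)$ mapping edges to edges. $f(n,r,k)$ is the maximum integer $s$ such that every $n$-vertex $(r,k)$-tournament contains a copy of $P^{(r)}_s$. For fixed $r$, the linear path threshold is the minimum $k$ such that $f(n,r,k)$ is linear in $n$, i.e. $f(n,r,k)=\Omega(n)$ as $n\to\infty$. *)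

theory Defs
  imports Complex_Main "HOL-Library.Landau_Symbols"
begin

record 'a hyperdigraph =
  verts :: "'a set"
  edges :: "'a list set"

definition r_digraph :: "nat \<Rightarrow> 'a hyperdigraph \<Rightarrow> bool" where
  "r_digraph r G \<longleftrightarrow> finite (verts G) \<and>
     (\<forall>e\<in>edges G. length e = r \<and> distinct e \<and> set e \<subseteq> verts G)"

(* In an r-digraph, the edges e with set e = S are exactly the orderings of S that are edges. *)
definition tournament :: "nat \<Rightarrow> nat \<Rightarrow> 'a hyperdigraph \<Rightarrow> bool" where
  "tournament r k G \<longleftrightarrow> r_digraph r G \<and> k \<le> fact r \<and>
     (\<forall>S\<subseteq>verts G. card S = r \<longrightarrow> card {e \<in> edges G. set e = S} = k)"

definition contains :: "'a hyperdigraph \<Rightarrow> 'b hyperdigraph \<Rightarrow> bool" where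
  "contains G H \<longleftrightarrow> (\<exists>\<phi>. inj_on \<phi> (verts H) \<and> \<phi> ` verts H \<subseteq> verts G \<and>
     (\<forall>e\<in>edges H. map \<phi> e \<in> edges G))"

(* The vertex v_i is the number i; the edges are the lists [i, ..., i + r - 1]
   with 1 <= i <= s - r + 1, the upper bound being written without subtraction. *)
definition tight_path :: "nat \<Rightarrow> nat \<Rightarrow> nat hyperdigraph" where
  "tight_path r s = \<lparr>verts = {1..s}, edges = {[i..<i + r] | i. 1 \<le> i \<and> i + r \<le> s + 1}\<rparr>"

(* Every finite r-digraph is isomorphic to one whose vertices are natural numbers, so
   quantifying over these loses nothing.  For k <= fact r an n-vertex (r,k)-tournament
   exists, so the set below is bounded by n; it always contains 0. *)
definition path_number :: "nat \<Rightarrow> nat \<Rightarrow> nat \<Rightarrow> nat" where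
  "path_number n r k = Max {s. \<forall>G :: nat hyperdigraph.
     tournament r k G \<and> card (verts G) = n \<longrightarrow> contains G (tight_path r s)}"

(* (r,k)-tournaments are only meaningful for k <= fact r. *)
definition linear_path_threshold :: "nat \<Rightarrow> nat" where
  "linear_path_threshold r =
     (LEAST k. k \<le> fact r \<and> (\<lambda>n. real (path_number n r k)) \<in> \<Omega>(\<lambda>n. real n))"

end

theory Submission
  imports Defs "HOL-Combinatorics.Multiset_Permutations"
begin

text \<open>
  With fewer than (r - 1)! non-edges on each r-set S, some ordering of S has all its r rotations
  among the edges, because every non-edge spoils only r of the r! orderings. Choose one such
  rotation class for each S and delete, one after the other, the classes that meet an
  (r - 1)-tuple with at most t extensions. Each deletion costs at most t classes and one tuple, so
  for t = \<lfloor>(n - r) / r!\<rfloor> something survives. The survivors are closed under rotation, so the last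
  r - 1 vertices of a tight path begin a surviving edge and hence have more than t extensions;
  in a longest tight path they are all on the path, which therefore has at least r + t vertices.
\<close>

section \<open>Rotations of lists and pruning of rotation-closed families\<close>

lemma rotate_inverse:
  assumes "e \<noteq> []"
  shows "\<exists>j<length e. rotate j (rotate i e) = e"
proof -
  let ?l = "length e"
  \<comment> \<open>The outer \<open>mod\<close> sends the value \<open>?l\<close>, which arises
    when \<open>?l\<close> divides \<open>i\<close>, to 0. The resulting bound
    \<open>?j < ?l\<close> later limits the orderings spoiled by one non-edge to
    \<open>r\<close>.\<close>
  let ?j = "(?l - i mod ?l) mod ?l"
  have l: "?l > 0" using assms by simp
  then have "(?j + i) mod ?l = (?l - i mod ?l + i mod ?l) mod ?l" by (metis mod_add_eq mod_mod_trivial)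
  also have "\<dots> = 0" using l by (simp add: less_imp_le)
  finally have "rotate ?j (rotate i e) = e" by (simp add: rotate_rotate)
  then show ?thesis using l by (intro exI[of _ ?j]) simp
qed

definition rotation_closed :: "'a list set \<Rightarrow> bool" where
  "rotation_closed D \<longleftrightarrow> (\<forall>e\<in>D. \<forall>i. rotate i e \<in> D)"

text \<open>Below, r * t pays for the rotations of the at most t lists extending a deleted prefix.\<close>

lemma dense_rotation_closed_subset:
  fixes D :: "'a list set"
  assumes "finite D" "rotation_closed D" "\<And>e. e \<in> D \<Longrightarrow> length e = r" "r > 0"
    and "card D > r * t * card (butlast ` D)"
  shows "\<exists>D'\<subseteq>D. D' \<noteq> {} \<and> rotation_closed D' \<and>
           (\<forall>p\<in>butlast ` D'. card {e\<in>D'. butlast e = p} > t)"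
  using assms
proof (induction "card D" arbitrary: D rule: less_induct)
  case less
  show ?case
  proof (cases "\<forall>p\<in>butlast ` D. card {e\<in>D. butlast e = p} > t")
    case True
    moreover have "D \<noteq> {}" using less.prems by auto
    ultimately show ?thesis using less.prems(2) by blast
  next
    case False
    then obtain p where p: "p \<in> butlast ` D" and few: "card {e\<in>D. butlast e = p} \<le> t"
      by (auto simp: not_less)
    define X where "X = {e\<in>D. butlast e = p}"
    \<comment> \<open>Whole rotation classes are removed, not just \<open>X\<close>, so that the
      rest stays closed under rotation.\<close>
    define R where "R = (\<lambda>(i, e). rotate i e) ` ({..<r} \<times> X)"
    define D' where "D' = D - R"
    have finX: "finite X" using less.prems(1) by (simp add: X_def)
    have "card R \<le> card ({..<r} \<times> X)"
      unfolding R_def by (intro card_image_le) (use finX in auto)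
    also have "\<dots> \<le> r * t" using few by (simp add: card_cartesian_product X_def)
    finally have cR: "card R \<le> r * t" .
    have R_sub: "R \<subseteq> D"
      using less.prems(2) by (auto simp: R_def X_def rotation_closed_def)
    have X_sub: "X \<subseteq> R"
    proof
      fix e assume "e \<in> X"
      then have "(\<lambda>(i, e). rotate i e) (0, e) \<in> R"
        unfolding R_def using less.prems(4) by (intro imageI) auto
      then show "e \<in> R" by simp
    qed
    have X_ne: "X \<noteq> {}" using p by (auto simp: X_def)
    have R_rot: "rotate j e \<in> R" if e: "e \<in> R" for e j
    proof -
      obtain i x where x: "x \<in> X" "e = rotate i x" using e by (auto simp: R_def)
      then have "length x = r" using less.prems(3) by (auto simp: X_def)
      then have "rotate j e = rotate ((j + i) mod r) x"
        using x by (metis rotate_conv_mod rotate_rotate)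
      then show ?thesis
        using x less.prems(4) by (auto simp: R_def intro!: image_eqI[where x = "((j + i) mod r, x)"])
    qed
    have rc: "rotation_closed D'"
      unfolding rotation_closed_def
    proof (intro ballI allI)
      fix e i assume e: "e \<in> D'"
      have "e \<noteq> []" using e less.prems(3,4) by (auto simp: D'_def)
      then obtain j where inverse: "rotate j (rotate i e) = e" using rotate_inverse by blast
      have "rotate i e \<notin> R"
      proof
        assume "rotate i e \<in> R"
        from R_rot[OF this, of j] inverse e show False by (simp add: D'_def)
      qed
      then show "rotate i e \<in> D'"
        using e less.prems(2) by (auto simp: D'_def rotation_closed_def)
    qed
    \<comment> \<open>Since \<open>X\<close> is part of \<open>R\<close>, no surviving list begins
      with \<open>p\<close>. Losing this prefix lowers the required bound by at least
      \<open>r * t\<close>, which makes up for the lists in \<open>R\<close>.\<close>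
    have bl: "butlast ` D' \<subseteq> butlast ` D - {p}"
      using X_sub by (auto simp: D'_def X_def)
    have "card (butlast ` D') \<le> card (butlast ` D - {p})"
      using bl less.prems(1) by (intro card_mono) auto
    also have "\<dots> = card (butlast ` D) - 1" using p by simp
    finally have "r * t * card (butlast ` D') \<le> r * t * (card (butlast ` D) - 1)"
      by (rule mult_le_mono2)
    then have "r * t * card (butlast ` D') \<le> r * t * card (butlast ` D) - r * t"
      by (simp only: diff_mult_distrib2 mult_1_right)
    moreover have cD': "card D' = card D - card R"
      unfolding D'_def using R_sub less.prems(1) by (meson card_Diff_subset finite_subset)
    \<comment> \<open>Positivity of the prefix count keeps the natural-number subtraction of
      \<open>r * t\<close> from being truncated.\<close>
    moreover have "card (butlast ` D) > 0" using p less.prems(1) by (metis card_gt_0_iff empty_iff finite_imageI)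
    then have "r * t \<le> r * t * card (butlast ` D)" by simp
    ultimately have big: "card D' > r * t * card (butlast ` D')"
      using cR less.prems(5) by linarith
    have "R \<noteq> {}" using X_sub X_ne by blast
    then have "D' \<subset> D" using R_sub by (auto simp: D'_def)
    then have "card D' < card D" using less.prems(1) by (simp add: psubset_card_mono)
    moreover have "finite D'" "\<And>e. e \<in> D' \<Longrightarrow> length e = r"
      using less.prems(1,3) by (auto simp: D'_def)
    ultimately obtain D'' where
      "D'' \<subseteq> D'" "D'' \<noteq> {}" "rotation_closed D''"
      "\<forall>p\<in>butlast ` D''. card {e\<in>D''. butlast e = p} > t"
      using less.hyps[OF _ _ rc _ less.prems(4) big] by blast
    moreover have "D' \<subseteq> D" by (simp add: D'_def)
    ultimately show ?thesis by (meson order_trans)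
  qed
qed

section \<open>Tight paths as vertex lists, and the longest-path argument\<close>

text \<open>The family \<open>D\<close> is a parameter so that a path found in a pruned family can
  be reread in the full edge set. A list shorter than \<open>r\<close> has only to be
  distinct.\<close>

definition is_tight_path :: "nat \<Rightarrow> 'a list set \<Rightarrow> 'a list \<Rightarrow> bool" where
  "is_tight_path r D w \<longleftrightarrow> distinct w \<and> (\<forall>i. i + r \<le> length w \<longrightarrow> take r (drop i w) \<in> D)"

text \<open>Appending \<open>x\<close> creates just one new window of length \<open>r\<close>: the
  last \<open>r - 1\<close> vertices followed by \<open>x\<close>.\<close>

lemma is_tight_path_extend:
  assumes "is_tight_path r D w" "r > 0" "r \<le> length w" "x \<notin> set w"
    and "drop (length w - (r - 1)) w @ [x] \<in> D"
  shows "is_tight_path r D (w @ [x])"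
  unfolding is_tight_path_def
proof (intro conjI allI impI)
  show "distinct (w @ [x])" using assms by (simp add: is_tight_path_def)
next
  fix i assume i: "i + r \<le> length (w @ [x])"
  show "take r (drop i (w @ [x])) \<in> D"
  proof (cases "i + r \<le> length w")
    case True
    then show ?thesis using assms(1) by (simp add: is_tight_path_def)
  next
    case False
    then have "i = length w - (r - 1)" using i assms(2,3) by simp
    then show ?thesis using assms(2,3,5) by simp
  qed
qed

text \<open>In a longest path \<open>w\<close>, the more than \<open>t\<close> extensions of the
  last \<open>r - 1\<close> vertices all lie among the \<open>length w - (r - 1)\<close> vertices
  before them.\<close>

lemma long_tight_path:
  fixes D :: "'a list set"
  assumes "finite D" "D \<noteq> {}" "rotation_closed D" "r > 0"
    and D: "\<And>e. e \<in> D \<Longrightarrow> length e = r \<and> distinct e"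
    and deg: "\<And>p. p \<in> butlast ` D \<Longrightarrow> card {e\<in>D. butlast e = p} > t"
  shows "\<exists>w. is_tight_path r D w \<and> r + t \<le> length w \<and> set w \<subseteq> \<Union>(set ` D)"
proof -
  define W where "W = {w. is_tight_path r D w \<and> r \<le> length w \<and> set w \<subseteq> \<Union>(set ` D)}"
  have finU: "finite (\<Union>(set ` D))" using assms(1) by auto
  have "W \<subseteq> {w. set w \<subseteq> \<Union>(set ` D) \<and> distinct w}" by (auto simp: W_def is_tight_path_def)
  then have finW: "finite W" using finite_subset_distinct[OF finU] by (rule finite_subset)
  obtain e where e: "e \<in> D" using assms(2) by blast
  have "e \<in> W" using e D[OF e] by (auto simp: W_def is_tight_path_def)
  then have "Max (length ` W) \<in> length ` W" using finW by (intro Max_in) auto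
  then obtain w where w: "w \<in> W" and lmax: "length w = Max (length ` W)" by fastforce
  have max: "length v \<le> length w" if "v \<in> W" for v
    using finW that unfolding lmax by (intro Max_ge) auto
  define q where "q = drop (length w - (r - 1)) w"
  have lw: "r \<le> length w" and tw: "is_tight_path r D w" and sw: "set w \<subseteq> \<Union>(set ` D)"
    using w by (auto simp: W_def)
  have "drop (length w - r) w \<in> D"
    using tw lw by (auto simp: is_tight_path_def dest: spec[of _ "length w - r"])
  moreover have "drop (length w - r) w = w ! (length w - r) # q"
    unfolding q_def using lw assms(4) by (subst Cons_nth_drop_Suc[symmetric]) (auto simp: Suc_diff_le)
  \<comment> \<open>The final window ends with \<open>q\<close>, but the degree bound concerns lists
    that begin with \<open>q\<close>; one rotation turns the former into the latter.\<close>
  ultimately have "rotate 1 (w ! (length w - r) # q) \<in> D"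
    using assms(3) by (metis rotation_closed_def)
  then have "q @ [w ! (length w - r)] \<in> D" by simp
  then have "q \<in> butlast ` D" by (metis butlast_snoc imageI)
  from deg[OF this] have t: "t < card {e\<in>D. butlast e = q}" .
  \<comment> \<open>An extension outside \<open>w\<close> would contradict maximality, and one
    inside \<open>q\<close> the distinctness of the lists in \<open>D\<close>.\<close>
  have "last ` {e\<in>D. butlast e = q} \<subseteq> set w - set q"
  proof safe
    fix e assume e: "e \<in> D" "q = butlast e"
    then have ne: "e \<noteq> []" using D assms(4) by fastforce
    have ed: "e = q @ [last e]" using e ne by simp
    show "last e \<in> set w"
    proof (rule ccontr)
      assume "last e \<notin> set w"
      then have "is_tight_path r D (w @ [last e])"
        using is_tight_path_extend[OF tw assms(4) lw] e(1) ed by (simp add: q_def)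
      moreover have "last e \<in> \<Union>(set ` D)" using e(1) ne by (auto intro: last_in_set)
      ultimately have "w @ [last e] \<in> W" using lw sw by (simp add: W_def)
      from max[OF this] show False by simp
    qed
    assume "last e \<in> set (butlast e)"
    then show False using D[OF e(1)] ed e(2) by (metis distinct_append disjoint_iff list.set_intros(1))
  qed
  then have "card (last ` {e\<in>D. butlast e = q}) \<le> card (set w - set q)"
    by (intro card_mono) auto
  moreover have "inj_on last {e\<in>D. butlast e = q}"
  proof (rule inj_onI, clarify)
    fix e e' assume "e \<in> D" "e' \<in> D" "q = butlast e" "butlast e' = butlast e" "last e = last e'"
    moreover from this have "e \<noteq> []" "e' \<noteq> []" using D assms(4) by fastforce+
    ultimately show "e = e'" by (metis append_butlast_last_id)
  qed
  moreover have "card (set w - set q) = length w - (r - 1)"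
  proof -
    have "distinct w" using tw by (simp add: is_tight_path_def)
    moreover have "set q \<subseteq> set w" by (simp add: q_def set_drop_subset)
    ultimately show ?thesis using lw
      by (simp add: card_Diff_subset distinct_card q_def)
  qed
  ultimately have "t < length w - (r - 1)" using t by (simp add: card_image)
  then have "r + t \<le> length w" using lw by linarith
  then show ?thesis using tw sw by blast
qed

section \<open>From vertex lists to copies of tight paths\<close>

lemma contains_tight_pathI:
  assumes "is_tight_path r (edges G) w" "set w \<subseteq> verts G" "s \<le> length w"
  shows "contains G (tight_path r s)"
proof -
  \<comment> \<open>The vertices of \<open>tight_path\<close> are numbered from 1, list positions
    from 0.\<close>
  define \<phi> where "\<phi> j = w ! (j - 1)" for j :: nat
  have "inj_on \<phi> {1..s}"
    using assms by (auto simp: inj_on_def \<phi>_def is_tight_path_def nth_eq_iff_index_eq)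
  moreover have "w ! (j - 1) \<in> set w" if "j \<in> {1..s}" for j
    using that assms(3) by (intro nth_mem) auto
  then have "\<phi> ` {1..s} \<subseteq> verts G" using assms(2) by (auto simp: \<phi>_def)
  moreover have "map \<phi> [i..<i + r] \<in> edges G" if "1 \<le> i" "i + r \<le> s + 1" for i
  proof -
    have "map \<phi> [i..<i + r] = take r (drop (i - 1) w)"
      using that assms(3) by (intro nth_equalityI) (auto simp: \<phi>_def)
    moreover have "(i - 1) + r \<le> length w" using that assms(3) by linarith
    ultimately show ?thesis using assms(1) by (simp add: is_tight_path_def)
  qed
  ultimately show ?thesis unfolding contains_def by (auto simp: tight_path_def intro!: exI[of _ \<phi>])
qed

text \<open>For \<open>s < r\<close> the path has no edges, so any \<open>s\<close> distinct
  vertices form a copy.\<close>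

lemma contains_small_tight_path:
  assumes "finite (verts G)" "s \<le> card (verts G)" "s < r"
  shows "contains G (tight_path r s)"
proof -
  obtain w where "set w = verts G" "distinct w" using finite_distinct_list[OF assms(1)] by blast
  moreover from this have "length w = card (verts G)" by (metis distinct_card)
  ultimately show ?thesis
    using assms by (intro contains_tight_pathI[of r G "take s w"])
      (auto simp: is_tight_path_def distinct_card dest: in_set_takeD)
qed

section \<open>Counting orderings and tuples\<close>

text \<open>Otherwise every ordering of \<open>S\<close> is a rotation of some non-edge in
  \<open>N\<close>. The \<open>r\<close> rotations of fewer than \<open>fact (r - 1)\<close>
  non-edges cannot cover all \<open>fact r\<close> orderings.\<close>

lemma exists_rotation_invariant_ordering:
  fixes E :: "'a list set"
  assumes "finite S" "card S = r" "r > 0"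
    and "card {e\<in>E. set e = S \<and> distinct e} > fact r - fact (r - 1)"
  shows "\<exists>e. distinct e \<and> set e = S \<and> (\<forall>i. rotate i e \<in> E)"
proof (rule ccontr)
  assume no: "\<not> ?thesis"
  define N where "N = permutations_of_set S - E"
  have cP: "card (permutations_of_set S) = fact r" using assms by simp
  have PE: "permutations_of_set S \<inter> E = {e\<in>E. set e = S \<and> distinct e}"
    by (auto simp: permutations_of_set_def)
  have "card N = fact r - card {e\<in>E. set e = S \<and> distinct e}"
    unfolding N_def PE[symmetric] cP[symmetric] by (intro card_Diff_subset_Int) simp
  moreover have "fact (r - 1) \<le> (fact r :: nat)" by (simp add: fact_mono)
  moreover have "fact (r - 1) > (0::nat)" by simp
  ultimately have cN: "card N < fact (r - 1)" using assms(4) by linarith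
  have "permutations_of_set S \<subseteq> (\<lambda>(i, e). rotate i e) ` ({..<r} \<times> N)"
  proof
    fix e assume "e \<in> permutations_of_set S"
    then have e: "distinct e" "set e = S" by (auto simp: permutations_of_set_def)
    then have len: "length e = r" using assms(2) distinct_card by fastforce
    obtain i where i: "rotate i e \<notin> E" using no e by blast
    have "e \<noteq> []" using len assms(3) by auto
    then obtain j where j: "j < r" "e = rotate j (rotate i e)"
      using rotate_inverse len by metis
    have "rotate i e \<in> N" using i e by (simp add: N_def permutations_of_set_def)
    then show "e \<in> (\<lambda>(i, e). rotate i e) ` ({..<r} \<times> N)"
      by (intro image_eqI[where x = "(j, rotate i e)"]) (use j in auto)
  qed
  then have "fact r \<le> card ((\<lambda>(i, e). rotate i e) ` ({..<r} \<times> N))"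
    unfolding cP[symmetric] by (intro card_mono finite_imageI) (auto simp: N_def)
  also have "\<dots> \<le> card ({..<r} \<times> N)" by (intro card_image_le) (auto simp: N_def)
  also have "\<dots> = r * card N" by (simp add: card_cartesian_product)
  also have "\<dots> < r * fact (r - 1)" using cN assms(3) by simp
  also have "\<dots> = fact r" using assms(3) by (simp add: fact_reduce)
  finally show False by simp
qed

text \<open>Both sides count the lists of \<open>r\<close> distinct elements of \<open>V\<close>: on
  the left by choosing the last entry after the others, on the right by ordering a chosen
  \<open>r\<close>-set.\<close>

lemma card_orderings_times:
  assumes "finite V" "0 < r" "r \<le> card V"
  shows "card {p. length p = r - 1 \<and> distinct p \<and> set p \<subseteq> V} * (card V - r + 1)
       = fact r * (card V choose r)"
proof -
  have "card {p. length p = r - 1 \<and> distinct p \<and> set p \<subseteq> V} = \<Prod>{card V - (r - 1) + 1..card V}"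
    using assms by (intro card_lists_distinct_length_eq) auto
  also have "card V - (r - 1) + 1 = Suc (card V - r + 1)" using assms by linarith
  finally have "card {p. length p = r - 1 \<and> distinct p \<and> set p \<subseteq> V} * (card V - r + 1)
      = \<Prod>{card V - r + 1..card V}"
    using assms by (subst prod.atLeast_Suc_atMost[of "card V - r + 1"]) auto
  moreover have "fact (card V - r) * \<Prod>{card V - r + 1..card V} = fact (card V)"
    using fact_eq_fact_times[of "card V - r" "card V"] by simp
  moreover have "fact r * fact (card V - r) * (card V choose r) = fact (card V)"
    using assms by (simp add: binomial_fact_lemma)
  ultimately have "fact (card V - r) * (card {p. length p = r - 1 \<and> distinct p \<and> set p \<subseteq> V} * (card V - r + 1))
      = fact (card V - r) * (fact r * (card V choose r))" by (simp add: mult_ac)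
  then show ?thesis by simp
qed

section \<open>Tight paths in tournaments with many edges on each \<open>r\<close>-set\<close>

text \<open>One good rotation class per \<open>r\<close>-set gives enough lists for pruning with
  \<open>t = (n - r) div fact r\<close>. The bound \<open>s \<le> n\<close> matters for
  \<open>n < r\<close>, where truncated subtraction leaves only \<open>s \<le> r\<close>.\<close>

lemma tournament_contains_tight_path:
  fixes G :: "'a hyperdigraph"
  assumes G: "tournament r k G" and "r > 0" and k: "k > fact r - fact (r - 1)"
    and n: "card (verts G) = n" and s: "s \<le> (n - r) div fact r + r" "s \<le> n"
  shows "contains G (tight_path r s)"
proof (cases "s < r")
  case True
  then show ?thesis
    using G s n by (intro contains_small_tight_path) (auto simp: tournament_def r_digraph_def)
next
  case False
  define V where "V = verts G"
  define t where "t = (n - r) div fact r"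
  have rn: "r \<le> n" using False s by simp
  have finV: "finite V" using G by (simp add: V_def tournament_def r_digraph_def)
  have edge: "length e = r \<and> distinct e \<and> set e \<subseteq> V" if "e \<in> edges G" for e
    using G that by (auto simp: V_def tournament_def r_digraph_def)
  define F where "F = {S. S \<subseteq> V \<and> card S = r}"
  have "\<exists>e. distinct e \<and> set e = S \<and> (\<forall>i. rotate i e \<in> edges G)" if "S \<in> F" for S
  proof (rule exists_rotation_invariant_ordering)
    show "finite S" using that finV finite_subset by (auto simp: F_def)
    show "card S = r" using that by (simp add: F_def)
    have "{e\<in>edges G. set e = S \<and> distinct e} = {e\<in>edges G. set e = S}" using edge by blast
    moreover have "card {e\<in>edges G. set e = S} = k"
      using G that by (simp add: tournament_def F_def V_def)
    ultimately show "card {e\<in>edges G. set e = S \<and> distinct e} > fact r - fact (r - 1)"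
      using k by simp
  qed (fact assms(2))
  then obtain c where c: "\<And>S. S \<in> F \<Longrightarrow> distinct (c S) \<and> set (c S) = S \<and> (\<forall>i. rotate i (c S) \<in> edges G)"
    by metis
  have lc: "length (c S) = r" if "S \<in> F" for S
    using c[OF that] that by (metis (mono_tags, lifting) F_def distinct_card mem_Collect_eq)
  \<comment> \<open>Letting the rotation index run over all naturals makes closure immediate; the
    indices below \<open>r\<close> then suffice for the lower bound on the size.\<close>
  define D where "D = (\<lambda>(S, i). rotate i (c S)) ` (F \<times> UNIV)"
  have DE: "D \<subseteq> edges G" using c by (auto simp: D_def)
  have rc: "rotation_closed D"
    unfolding rotation_closed_def D_def by (force simp: rotate_rotate)
  have finE: "finite (edges G)"
  proof (rule finite_subset)
    show "edges G \<subseteq> {e. set e \<subseteq> V \<and> length e = r}" using edge by auto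
  qed (use finV in \<open>rule finite_lists_length_eq\<close>)
  have finD: "finite D" using finE DE by (rule finite_subset[rotated])
  have "inj_on (\<lambda>(S, i). rotate i (c S)) (F \<times> {..<r})"
  proof (rule inj_onI, clarify)
    fix S i S' i' assume a: "S \<in> F" "S' \<in> F" "i < r" "i' < r" "rotate i (c S) = rotate i' (c S')"
    then have S: "S = S'" using c by (metis set_rotate)
    \<comment> \<open>The first entry of a rotation of the distinct list \<open>c S\<close>
      determines the index.\<close>
    have "rotate i (c S) ! 0 = c S ! i" "rotate i' (c S) ! 0 = c S ! i'"
      using a(3,4) lc[OF a(1)] by (simp_all add: nth_rotate)
    then have "i = i'" using a S c[OF a(1)] lc[OF a(1)] by (metis nth_eq_iff_index_eq)
    then show "S = S' \<and> i = i'" using S by simp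
  qed
  then have "card (F \<times> {..<r}) = card ((\<lambda>(S, i). rotate i (c S)) ` (F \<times> {..<r}))"
    by (simp add: card_image)
  also have "\<dots> \<le> card D" unfolding D_def using finD by (intro card_mono) (auto simp: D_def)
  finally have cD: "r * (n choose r) \<le> card D"
    using n_subsets[OF finV, of r] n by (simp add: card_cartesian_product F_def V_def mult.commute)
  define Q where "Q = {p. length p = r - 1 \<and> distinct p \<and> set p \<subseteq> V}"
  have "butlast ` D \<subseteq> Q"
    using DE edge by (fastforce simp: Q_def distinct_butlast dest: in_set_butlastD)
  moreover have finQ: "finite Q"
    by (rule finite_subset[OF _ finite_lists_length_eq[OF finV, of "r - 1"]]) (auto simp: Q_def)
  ultimately have cQ: "card (butlast ` D) \<le> card Q" by (intro card_mono)
  have id: "card Q * (n - r + 1) = fact r * (n choose r)"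
    using card_orderings_times[OF finV assms(2)] rn n by (simp add: Q_def V_def)
  have "fact r * (n choose r) > 0" using rn by simp
  then have Qpos: "card Q > 0" using id by (metis gr0I mult_0)
  \<comment> \<open>By the choice of \<open>t\<close>,
    \<open>fact r * t \<le> n - r < n - r + 1\<close>; the strict inequality, multiplied by
    \<open>card Q\<close> and combined with \<open>id\<close>, yields the bound after cancelling
    \<open>fact r\<close>.\<close>
  have "fact r * (t * card Q) \<le> (n - r) * card Q"
    by (simp add: t_def mult.assoc[symmetric])
  also have "\<dots> < card Q * (n - r + 1)" using Qpos by simp
  finally have "t * card Q < n choose r" unfolding id by simp
  moreover have "t * card (butlast ` D) \<le> t * card Q" using cQ by simp
  ultimately have "t * card (butlast ` D) < n choose r" by linarith
  then have "r * t * card (butlast ` D) < r * (n choose r)"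
    using assms(2) by (simp add: mult.assoc)
  also note cD
  finally have big: "card D > r * t * card (butlast ` D)" .
  obtain D' where D': "D' \<subseteq> D" "D' \<noteq> {}" "rotation_closed D'"
      "\<forall>p\<in>butlast ` D'. card {e\<in>D'. butlast e = p} > t"
    using dense_rotation_closed_subset[OF finD rc _ assms(2) big] DE edge by blast
  obtain w where w: "is_tight_path r D' w" "r + t \<le> length w" "set w \<subseteq> \<Union>(set ` D')"
    using long_tight_path[OF finite_subset[OF D'(1) finD] D'(2,3) assms(2), of t] D'(1,4) DE edge
    by blast
  show ?thesis
  proof (rule contains_tight_pathI)
    show "is_tight_path r (edges G) w" using w(1) D'(1) DE by (auto simp: is_tight_path_def)
    show "set w \<subseteq> verts G" using w(3) D'(1) DE edge by (fastforce simp: V_def)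
    show "s \<le> length w" using w(2) s by (simp add: t_def)
  qed
qed

section \<open>Path numbers and the linear threshold\<close>

text \<open>Different \<open>r\<close>-sets share no orderings, so \<open>k\<close> orderings can be
  chosen for each independently. Without such a tournament every \<open>s\<close> would vacuously
  qualify in \<open>path_number\<close>.\<close>

lemma tournament_exists:
  assumes "finite V" "k \<le> fact r"
  shows "\<exists>G. tournament r k G \<and> verts G = V"
proof -
  have "\<exists>X\<subseteq>permutations_of_set S. card X = k" if "S \<subseteq> V" "card S = r" for S
  proof -
    have "card (permutations_of_set S) = fact r"
      using that finite_subset[OF that(1) assms(1)] by simp
    then show ?thesis using assms(2) by (metis obtain_subset_with_card_n)
  qed
  then obtain X where X: "\<And>S. S \<subseteq> V \<Longrightarrow> card S = r \<Longrightarrow> X S \<subseteq> permutations_of_set S \<and> card (X S) = k"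
    by metis
  define E where "E = (\<Union>S\<in>{S. S \<subseteq> V \<and> card S = r}. X S)"
  have X_set: "set e = S \<and> distinct e" if "S \<subseteq> V" "card S = r" "e \<in> X S" for S e
    using X[OF that(1,2)] that(3) by (auto dest: permutations_of_setD)
  have "{e\<in>E. set e = S} = X S" if "S \<subseteq> V" "card S = r" for S
    using X_set that by (auto simp: E_def)
  moreover have "length e = r \<and> distinct e \<and> set e \<subseteq> V" if "e \<in> E" for e
    using that X_set distinct_card[of e] by (auto simp: E_def)
  ultimately have "tournament r k \<lparr>verts = V, edges = E\<rparr>"
    using assms X by (simp add: tournament_def r_digraph_def)
  then show ?thesis by (intro exI[of _ "\<lparr>verts = V, edges = E\<rparr>"]) simp
qed

text \<open>An existing tournament on \<open>n\<close> vertices forces every admissible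
  \<open>s\<close> to be at most \<open>n\<close>, so \<open>Max\<close> is taken over a finite
  set.\<close>

lemma path_number_ge:
  assumes "k \<le> fact r"
    and "\<And>G :: nat hyperdigraph. tournament r k G \<Longrightarrow> card (verts G) = n \<Longrightarrow> contains G (tight_path r s)"
  shows "s \<le> path_number n r k"
proof -
  define A where "A = {s. \<forall>G :: nat hyperdigraph.
     tournament r k G \<and> card (verts G) = n \<longrightarrow> contains G (tight_path r s)}"
  obtain G :: "nat hyperdigraph" where G: "tournament r k G" "verts G = {..<n}"
    using tournament_exists[OF _ assms(1), of "{..<n}"] by auto
  have "A \<subseteq> {..n}"
  proof
    fix s assume "s \<in> A"
    then have "contains G (tight_path r s)" using G by (simp add: A_def)
    then obtain \<phi> where "inj_on \<phi> {1..s}" "\<phi> ` {1..s} \<subseteq> {..<n}"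
      using G(2) by (auto simp: contains_def tight_path_def)
    then have "card {1..s} \<le> card {..<n}" using card_inj_on_le by blast
    then show "s \<in> {..n}" by simp
  qed
  then have "finite A" using finite_subset by blast
  moreover have "s \<in> A" using assms(2) by (simp add: A_def)
  ultimately show ?thesis unfolding path_number_def A_def[symmetric] by (rule Max_ge)
qed

lemma path_number_lower_bound:
  assumes "r > 0"
  shows "real (path_number n r (fact r - fact (r - 1) + 1)) \<ge> real n / fact r"
proof -
  define k :: nat where "k = fact r - fact (r - 1) + 1"
  define s where "s = min n ((n - r) div fact r + r)"
  have le: "fact (r - 1) \<le> (fact r :: nat)" by (simp add: fact_mono)
  have kr: "k \<le> fact r"
    using le fact_ge_1[of "r - 1", where ?'a = nat] unfolding k_def by linarith
  have "s \<le> path_number n r k"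
    using assms by (intro path_number_ge kr tournament_contains_tight_path) (auto simp: k_def s_def)
  moreover have "n \<le> s * fact r"
  proof (cases "s = n")
    case True
    then show ?thesis by simp
  next
    case False
    then have s: "s = (n - r) div fact r + r" and "r < n" by (auto simp: s_def min_def split: if_splits)
    have "n - r = (n - r) div fact r * fact r + (n - r) mod fact r" by simp
    moreover have "(n - r) mod fact r < fact r" by simp
    moreover have "r \<le> fact r" by (rule fact_ge_self)
    \<comment> \<open>Of the \<open>r\<close> copies of \<open>fact r\<close>, one absorbs the
      remainder and one unit more; the others cover the remaining \<open>r - 1\<close>.\<close>
    moreover have "s * fact r = (n - r) div fact r * fact r + fact r + (r - 1) * fact r"
      unfolding s using assms by (cases r) (simp_all add: algebra_simps)
    moreover have "(r - 1) * 1 \<le> (r - 1) * fact r" by (intro mult_le_mono2) simp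
    ultimately show ?thesis using \<open>r < n\<close> by linarith
  qed
  ultimately have "n \<le> path_number n r k * fact r" by (meson le_trans mult_le_mono1)
  then have "real n \<le> real (path_number n r k) * fact r"
    by (metis of_nat_fact of_nat_le_iff of_nat_mult)
  then show ?thesis by (simp add: k_def divide_le_eq)
qed

theorem theorem18:
  fixes r :: nat
  assumes "r > 0"
  shows "(\<forall>n k :: nat. n > 0 \<and> real k = (1 - 1 / real r + 1 / fact r) * fact r \<longrightarrow>
            real (path_number n r k) \<ge> real n / fact r) \<and>
         real (linear_path_threshold r) \<le> (1 - 1 / real r + 1 / fact r) * fact r"
proof -
  define K :: nat where "K = fact r - fact (r - 1) + 1"
  have le: "fact (r - 1) \<le> (fact r :: nat)" by (simp add: fact_mono)
  have Kr: "K \<le> fact r"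
    using le fact_ge_1[of "r - 1", where ?'a = nat] unfolding K_def by linarith
  \<comment> \<open>Hence \<open>fact r / r\<close> is \<open>fact (r - 1)\<close>, which identifies
    \<open>K\<close> with the real expression in the statement.\<close>
  have "(fact r :: real) = real r * fact (r - 1)" using assms by (simp add: fact_reduce)
  then have K: "real K = (1 - 1 / real r + 1 / fact r) * fact r"
    using le assms by (simp add: K_def of_nat_diff field_simps)
  have "(\<lambda>n. real (path_number n r K)) \<in> \<Omega>(\<lambda>n. real n)"
  proof (rule landau_omega.bigI[where c = "1 / fact r"])
    show "\<forall>\<^sub>F n in sequentially. norm (real (path_number n r K)) \<ge> 1 / fact r * norm (real n)"
      using path_number_lower_bound[OF assms] by (simp add: K_def)
  qed simp
  then have "linear_path_threshold r \<le> K"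
    unfolding linear_path_threshold_def using Kr by (intro Least_le) simp
  then have "real (linear_path_threshold r) \<le> real K" by simp
  \<comment> \<open>Injectivity of \<open>real\<close> forces every \<open>k\<close> satisfying the
    stated equation to be \<open>K\<close>.\<close>
  then show ?thesis
    using path_number_lower_bound[OF assms] K unfolding K_def[symmetric] by (metis of_nat_eq_iff)
qed

end
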